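(* Let $\mathcal{A}$ be a unital $C^*$-algebra and let $a\in\mathcal{A}$ and $b,c\in\hat{\mathcal{A}}$ be such that $a$ is $(b,c)$-invertible and $a^{-(b,c)}\neq0$. Suppose that $(a_n)_{n\in\mathbb{N}}\subset\mathcal{A}$ and $(b_n)_{n\in\mathbb{N}},(c_n)_{n\in\mathbb{N}}\subset\hat{\mathcal{A}}$ are sequences such that $a_n$ is $(b_n,c_n)$-invertible for each $n\in\mathbb{N}$. If $(a_n)_{n\in\mathbb{N}}$ converges to $a$, then the following statements (i)-(iv) are equivalent (limits as $n\to\infty$). (i) $a_n^{-(b_n,c_n)}\to a^{-(b,c)}$. (ii) $a_n^{-(b_n,c_n)}a_n\to a^{-(b,c)}a$ and $c_n^\dag c_n\to c^\dag c$. (iii) $a_na_n^{-(b_n,c_n)}\to aa^{-(b,c)}$ and $b_nb_n^\dag\to bb^\dag$. (iv) $b_nb_n^\dag\to bb^\dag$ and $c_n^\dag c_n\to c^\dag c$. In addition, if $(b_n)_{n\in\mathbb{N}}$ converges to $b$, then statement (iii) is equivalent to: (v) $a_na_n^{-(b_n,c_n)}\to aa^{-(b,c)}$ and $b_n^\dag\to b^\dag$. Moreover, if $(c_n)_{n\in\mathbb{N}}$ converges to $c$, then statement (ii) is equivalent to: (vi) $a_n^{-(b_n,c_n)}a_n\to a^{-(b,c)}a$ and $c_n^\dag\to c^\dag$. Furthermore, if $(b_n)_{n\in\mathbb{N}}$ and $(c_n)_{n\in\mathbb{N}}$ converge to $b$ and $c$, respectively, then statement (iv) is equivalent to: (vii)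 $b_n^\dag\to b^\dag$ and $c_n^\dag\to c^\dag$.
   Context: $\hat{\mathcal{A}}$ is the set of regular elements of $\mathcal{A}$ ($x=xyx$ for some $y\in\mathcal{A}$). For $b,c\in\mathcal{A}$, $a\in\mathcal{A}$ is $(b,c)$-invertible if there exists $y\in\mathcal{A}$ such that $y\in (b\mathcal{A}y)\cap(y\mathcal{A}c)$, $b=yab$ and $c=cay$; such $y$ is unique when it exists and is denoted $a^{-(b,c)}$. For $x\in\mathcal{A}$, the Moore-Penrose inverse $x^\dag$ is the unique (if it exists) $y\in\mathcal{A}$ with $x=xyx$, $y=yxy$, $(xy)^*=xy$, $(yx)^*=yx$. In a unital $C^*$-algebra every regular element has a Moore-Penrose inverse (known result of Harte and Mbekhta). *)

theory Defs
  imports "HOL-Analysis.Analysis"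
begin

text \<open>
  The superclass \<^class>\<open>real_normed_algebra_1\<close> contributes the ring structure, the submultiplicative norm
  and the (real) vector space structure; the complex scalar multiplication is required to extend
  the real one. The superclass also demands \<open>0 \<noteq> 1\<close> and \<open>norm 1 = 1\<close>: the first excludes only
  the zero algebra, and the second then follows from the \<open>C*\<close>-identity.
\<close>

class unital_cstar_algebra = real_normed_algebra_1 + complete_space +
  fixes scaleC :: "complex \<Rightarrow> 'a \<Rightarrow> 'a" (infixr "*\<^sub>C" 75)
    and star :: "'a \<Rightarrow> 'a"
  assumes scaleR_eq_scaleC: "r *\<^sub>R x = complex_of_real r *\<^sub>C x"
    and scaleC_add_right: "k *\<^sub>C (x + y) = k *\<^sub>C x + k *\<^sub>C y"
    and scaleC_add_left: "(k + l) *\<^sub>C x = k *\<^sub>C x + l *\<^sub>C x"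
    and scaleC_scaleC: "k *\<^sub>C l *\<^sub>C x = (k * l) *\<^sub>C x"
    and scaleC_one: "1 *\<^sub>C x = x"
    and mult_scaleC_left: "(k *\<^sub>C x) * y = k *\<^sub>C (x * y)"
    and mult_scaleC_right: "x * (k *\<^sub>C y) = k *\<^sub>C (x * y)"
    and norm_scaleC: "norm (k *\<^sub>C x) = cmod k * norm x"
    and star_add: "star (x + y) = star x + star y"
    and star_scaleC: "star (k *\<^sub>C x) = cnj k *\<^sub>C star x"
    and star_mult: "star (x * y) = star y * star x"
    and star_star: "star (star x) = x"
    and cstar_identity: "norm (star x * x) = (norm x)\<^sup>2"

instantiation complex :: unital_cstar_algebra
begin
definition "scaleC_complex = ((*) :: complex \<Rightarrow> complex \<Rightarrow> complex)"
definition "star_complex = cnj"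
instance
  by standard
    (simp_all add: scaleC_complex_def star_complex_def scaleR_conv_of_real algebra_simps
       norm_mult power2_eq_square)
end

definition regular_element :: "'a::semigroup_mult \<Rightarrow> bool" where
  "regular_element x \<longleftrightarrow> (\<exists>y. x = x * y * x)"

definition is_bc_inverse :: "'a::semigroup_mult \<Rightarrow> 'a \<Rightarrow> 'a \<Rightarrow> 'a \<Rightarrow> bool" where
  "is_bc_inverse b c a y \<longleftrightarrow>
     y \<in> {b * x * y |x. True} \<inter> {y * x * c |x. True} \<and> b = y * a * b \<and> c = c * a * y"

definition bc_invertible :: "'a::semigroup_mult \<Rightarrow> 'a \<Rightarrow> 'a \<Rightarrow> bool" where
  "bc_invertible b c a \<longleftrightarrow> (\<exists>y. is_bc_inverse b c a y)"

definition bc_inverse :: "'a::semigroup_mult \<Rightarrow> 'a \<Rightarrow> 'a \<Rightarrow> 'a" where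
  "bc_inverse b c a = (THE y. is_bc_inverse b c a y)"

definition is_mp_inverse :: "'a::unital_cstar_algebra \<Rightarrow> 'a \<Rightarrow> bool" where
  "is_mp_inverse x y \<longleftrightarrow>
     x = x * y * x \<and> y = y * x * y \<and> star (x * y) = x * y \<and> star (y * x) = y * x"

definition mp_inverse :: "'a::unital_cstar_algebra \<Rightarrow> 'a" where
  "mp_inverse x = (THE y. is_mp_inverse x y)"

lemma is_bc_inverse_unique:
  assumes "is_bc_inverse b c a y" "is_bc_inverse b c a z"
  shows "y = z"
proof -
  from assms obtain u v where u: "y = y * u * c" and v: "z = b * v * z"
    and b: "b = y * a * b" and c: "c = c * a * z"
    unfolding is_bc_inverse_def by blast
  have "y = y * u * (c * a * z)" using u c by simp
  also have "\<dots> = (y * u * c) * a * z" by (simp add: mult.assoc)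
  also have "\<dots> = y * a * z" using u by simp
  also have "\<dots> = y * a * (b * v * z)" using v by simp
  also have "\<dots> = (y * a * b) * v * z" by (simp add: mult.assoc)
  also have "\<dots> = z" using b v by simp
  finally show ?thesis .
qed

lemma bc_inverse_eq: "is_bc_inverse b c a y \<Longrightarrow> bc_inverse b c a = y"
  unfolding bc_inverse_def by (blast intro: is_bc_inverse_unique)

lemma is_mp_inverse_unique:
  assumes y: "is_mp_inverse x y" and z: "is_mp_inverse x z"
  shows "y = z"
proof -
  have y1: "x = x * y * x" and y2: "y = y * x * y"
    and y3: "star (x * y) = x * y" and y4: "star (y * x) = y * x"
    using y unfolding is_mp_inverse_def by blast+
  have z1: "x = x * z * x" and z2: "z = z * x * z"
    and z3: "star (x * z) = x * z" and z4: "star (z * x) = z * x"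
    using z unfolding is_mp_inverse_def by blast+
  have "x * y = star ((x * z) * (x * y))"
    using y3 z1 by (metis mult.assoc)
  also have "\<dots> = (x * y) * (x * z)"
    by (simp only: star_mult[of "x * z"] y3 z3)
  also have "\<dots> = x * z" using y1 by (metis mult.assoc)
  finally have l: "x * y = x * z" .
  have "y * x = star ((y * x) * (z * x))"
    using y4 z1 by (metis mult.assoc)
  also have "\<dots> = (z * x) * (y * x)"
    by (simp only: star_mult[of "y * x"] y4 z4)
  also have "\<dots> = z * x" using y1 by (metis mult.assoc)
  finally have r: "y * x = z * x" .
  show ?thesis using y2 z2 l r by (metis mult.assoc)
qed

lemma mp_inverse_eq: "is_mp_inverse x y \<Longrightarrow> mp_inverse x = y"
  unfolding mp_inverse_def by (blast intro: is_mp_inverse_unique)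

end

theory Submission
  imports Defs
begin

text \<open>
  Write \<open>y = a\<^bsup>-(b,c)\<^esup>\<close>, \<open>P = b b\<^sup>\<dagger>\<close> and \<open>Q = c\<^sup>\<dagger> c\<close>. Then \<open>y a y = y\<close>, \<open>P\<close> is the orthogonal
  projection with the range of the idempotent \<open>y a\<close>, and \<open>Q\<close> the one with the kernel of the
  idempotent \<open>a y\<close>. Since the orthogonal projection \<open>p\<close> with the range of an idempotent \<open>e\<close>
  satisfies \<open>p e = e\<close> and \<open>e p = p\<close>, one gets \<open>\<parallel>p' - p\<parallel> \<le> 2 \<parallel>e' - e\<parallel>\<close>; hence each of (i), (ii), (iii)
  implies (iv). Conversely, (iv) gives (i) because
  \<open>y\<^sub>n - y = ((1 - y a)(P\<^sub>n - P) + y (a - a\<^sub>n) + y (Q - Q\<^sub>n) a\<^sub>n) y\<^sub>n - y (Q - Q\<^sub>n)\<close>,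
  which also forces \<open>y\<^sub>n\<close> to be bounded. The statements on Moore-Penrose inverses follow from a
  similar identity. Regular elements have Moore-Penrose inverses because \<open>1 - z\<^sup>2\<close> is invertible for
  \<open>z = e - e\<^sup>*\<close>, which makes the orthogonal projection \<open>e e\<^sup>* (1 - z\<^sup>2)\<^sup>-\<^sup>1\<close> available for every idempotent \<open>e\<close>.
\<close>

instance unital_cstar_algebra \<subseteq> banach ..

subsection \<open>Involution and projections\<close>

lemma star_zero [simp]: "star (0::'a::unital_cstar_algebra) = 0"
  using star_add[of "0::'a" 0] by simp

lemma star_diff: "star (x - y) = star x - star (y::'a::unital_cstar_algebra)"
  using star_add[of "x - y" y] by (simp add: algebra_simps)

lemma star_minus: "star (- x) = - star (x::'a::unital_cstar_algebra)"
  using star_diff[of 0 x] by simp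

lemma star_one [simp]: "star (1::'a::unital_cstar_algebra) = 1"
  using star_mult[of "star (1::'a)" 1] by (simp add: star_star)

lemma star_scaleR: "star (r *\<^sub>R x) = r *\<^sub>R star (x::'a::unital_cstar_algebra)"
  by (simp add: scaleR_eq_scaleC star_scaleC)

lemma norm_star [simp]: "norm (star x) = norm (x::'a::unital_cstar_algebra)"
proof -
  have le: "norm x \<le> norm (star x)" for x :: 'a
  proof (cases "x = 0")
    case False
    have "norm x * norm x \<le> norm (star x) * norm x"
      using norm_mult_ineq[of "star x" x] cstar_identity[of x] by (simp add: power2_eq_square)
    then show ?thesis using False by simp
  qed simp
  show ?thesis using le[of x] le[of "star x"] by (simp add: star_star)
qed

lemma tendsto_star:
  fixes x :: "'a::unital_cstar_algebra"
  assumes "(f \<longlongrightarrow> x) F"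
  shows "((\<lambda>n. star (f n)) \<longlongrightarrow> star x) F"
proof -
  have "((\<lambda>n. norm (star (f n) - star x)) \<longlongrightarrow> 0) F"
    using assms by (simp add: star_diff[symmetric] tendsto_norm_zero_iff LIM_zero_iff)
  then show ?thesis by (simp add: tendsto_norm_zero_iff LIM_zero_iff)
qed

lemma norm_projection_le_one:
  fixes p :: "'a::unital_cstar_algebra"
  assumes "star p = p" "p * p = p"
  shows "norm p \<le> 1"
  using cstar_identity[of p] assms by (cases "p = 0") (simp_all add: power2_eq_square)

text \<open>The hypotheses make \<open>p\<close> and \<open>p'\<close> the orthogonal projections
  onto the ranges of \<open>e\<close> and \<open>e'\<close>. The factor 2 comes from the splitting
  \<open>p' - p = p' * (1 - p) - (1 - p') * p\<close>, each part having norm at most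
  \<open>norm (e' - e)\<close>.\<close>

lemma norm_range_projection_diff:
  fixes p p' e e' :: "'a::unital_cstar_algebra"
  assumes p: "star p = p" "p * e = e" "e * p = p"
    and p': "star p' = p'" "p' * e' = e'" "e' * p' = p'"
  shows "norm (p' - p) \<le> 2 * norm (e' - e)"
proof -
  \<comment> \<open>Since \<open>(1 - r) * f = 0\<close> and \<open>g * s = s\<close>, the product
    equals \<open>(1 - r) * (g - f) * s\<close>, whose outer factors are projections.\<close>
  have *: "norm ((1 - r) * s) \<le> norm (f - g)"
    if r: "star r = r" "r * f = f" "f * r = r" and s: "star s = s" "s * g = g" "g * s = s"
    for r s f g :: 'a
  proof -
    have rr: "r * r = r" and ss: "s * s = s" using r s by (metis mult.assoc)+
    have "norm (1 - r) \<le> 1"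
      using r rr by (intro norm_projection_le_one) (simp_all add: star_diff algebra_simps)
    moreover have "norm s \<le> 1" using s ss by (intro norm_projection_le_one)
    moreover have "(1 - r) * s = (1 - r) * (g - f) * s"
      using r s by (simp add: algebra_simps mult.assoc flip: mult.assoc[of r f])
    moreover have "norm ((1 - r) * (g - f) * s) \<le> norm (1 - r) * norm (g - f) * norm s"
      by (meson norm_mult_ineq mult_right_mono norm_ge_zero order_trans)
    moreover have "\<dots> \<le> 1 * norm (g - f) * 1"
      using calculation(1,2) by (intro mult_mono) auto
    ultimately show ?thesis by (simp add: norm_minus_commute)
  qed
  \<comment> \<open>The factors stand in the wrong order for \<open>*\<close>; the isometric
    involution swaps them.\<close>
  have "star ((1 - p) * p') = p' * (1 - p)"
    using p p' by (simp add: star_mult star_diff)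
  then have "norm (p' * (1 - p)) = norm ((1 - p) * p')" by (metis norm_star)
  then have "norm (p' * (1 - p)) \<le> norm (e' - e)"
    using *[OF p p'] by (simp add: norm_minus_commute)
  moreover have "norm ((1 - p') * p) \<le> norm (e' - e)" using *[OF p' p] .
  moreover have "p' - p = p' * (1 - p) - (1 - p') * p" by (simp add: algebra_simps)
  ultimately show ?thesis
    using norm_triangle_ineq4[of "p' * (1 - p)" "(1 - p') * p"] by simp
qed

lemma tendsto_range_projection:
  fixes p e :: "'a::unital_cstar_algebra"
  assumes "star p = p" "p * e = e" "e * p = p"
    and "\<And>n. star (p' n) = p' n" "\<And>n. p' n * e' n = e' n" "\<And>n. e' n * p' n = p' n"
    and "(e' \<longlongrightarrow> e) F"
  shows "(p' \<longlongrightarrow> p) F"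
proof -
  have "((\<lambda>n. e' n - e) \<longlongrightarrow> 0) F" using assms(7) by (simp add: LIM_zero)
  moreover have "norm (p' n - p) \<le> norm (e' n - e) * 2" for n
    using norm_range_projection_diff[OF assms(1-3) assms(4-6), of n] by simp
  ultimately have "((\<lambda>n. p' n - p) \<longlongrightarrow> 0) F" by (auto intro: tendsto_0_le[where K = 2])
  then show ?thesis by (simp add: LIM_zero_iff)
qed

subsection \<open>Existence of Moore-Penrose inverses\<close>

lemma neumann_inverse:
  fixes x :: "'a::{real_normed_algebra_1,banach}"
  assumes "norm x < 1"
  obtains w where "(1 - x) * w = 1" "w * (1 - x) = 1"
proof -
  have s: "summable (\<lambda>n. x ^ n)" using assms by (rule complete_algebra_summable_geometric)
  have t: "(\<lambda>n. x ^ Suc n) sums (suminf ((^) x) - 1)"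
    using summable_sums[OF s] sums_Suc_iff[of "\<lambda>n. x ^ n"] by simp
  have "x * suminf ((^) x) = suminf ((^) x) - 1"
    using sums_unique2[OF sums_mult[OF summable_sums[OF s], of x]] t by simp
  moreover have "suminf ((^) x) * x = suminf ((^) x) - 1"
    using sums_unique2[OF sums_mult2[OF summable_sums[OF s], of x]] t
    by (simp add: power_commutes)
  ultimately show ?thesis
    by (intro that[of "suminf ((^) x)"]) (simp_all add: algebra_simps)
qed

lemma skew_adjoint_one_minus_invertible:
  fixes z :: "'a::unital_cstar_algebra"
  assumes "star z = - z"
  obtains w where "(1 - z) * w = 1" "w * (1 - z) = 1"
proof -
  \<comment> \<open>Arens' trick: \<open>\<parallel>t + z\<parallel>\<^sup>2 = \<parallel>t\<^sup>2 - z\<^sup>2\<parallel> \<le> t\<^sup>2 + \<parallel>z\<parallel>\<^sup>2 < (1 + t)\<^sup>2\<close> for \<open>t = \<parallel>z\<parallel>\<^sup>2\<close>, so that the Neumann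
    series inverts \<open>(1 + t) - (t + z)\<close>.\<close>
  define t where "t = (norm z)\<^sup>2"
  define u where "u = of_real t + z"
  have t0: "t \<ge> 0" by (simp add: t_def)
  have "star u * u = of_real (t\<^sup>2) - z * z"
    using assms by (simp add: u_def of_real_def star_add star_scaleR algebra_simps power2_eq_square)
  then have "(norm u)\<^sup>2 = norm (of_real (t\<^sup>2) - z * z)" using cstar_identity[of u] by simp
  also have "\<dots> \<le> norm (of_real (t\<^sup>2) :: 'a) + norm (z * z)" by (rule norm_triangle_ineq4)
  also have "\<dots> \<le> t\<^sup>2 + t"
    using norm_mult_ineq[of z z] by (simp add: t_def power2_eq_square del: of_real_mult of_real_power)
  also have "\<dots> < (1 + t)\<^sup>2" using t0 by (simp add: power2_eq_square algebra_simps)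
  finally have "norm u < 1 + t" using t0 by (simp add: power2_less_imp_less)
  then have "norm ((1 / (1 + t)) *\<^sub>R u) < 1" using t0 by simp
  then obtain w where w: "(1 - (1 / (1 + t)) *\<^sub>R u) * w = 1" "w * (1 - (1 / (1 + t)) *\<^sub>R u) = 1"
    by (rule neumann_inverse)
  have "1 - z = (1 + t) *\<^sub>R (1 - (1 / (1 + t)) *\<^sub>R u)"
    using t0 unfolding scaleR_right_diff_distrib
    by (simp add: u_def of_real_def scaleR_left_distrib)
  then show ?thesis
    using w t0 by (intro that[of "(1 / (1 + t)) *\<^sub>R w"]) simp_all
qed

text \<open>For \<open>z = e - star e\<close>, both \<open>e * N\<close> and \<open>N * e\<close>
  equal \<open>e * star e * e\<close>, where \<open>N\<close> is 1 minus the square of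
  \<open>z\<close>. So the self-adjoint inverse \<open>W\<close> of \<open>N\<close> commutes with
  \<open>e\<close> and \<open>star e\<close>; this makes \<open>p = e * star e * W\<close>
  self-adjoint and gives \<open>p * e = e * N * W = e\<close>.\<close>

lemma range_projection_exists:
  fixes e :: "'a::unital_cstar_algebra"
  assumes e: "e * e = e"
  obtains p where "star p = p" "p * e = e" "e * p = p"
proof -
  define z where "z = e - star e"
  define N where "N = (1 - z) * (1 + z)"
  have sz: "star z = - z" by (simp add: z_def star_diff star_star)
  obtain w where w: "(1 - z) * w = 1" "w * (1 - z) = 1"
    using skew_adjoint_one_minus_invertible[OF sz] by blast
  obtain v where v: "(1 + z) * v = 1" "v * (1 + z) = 1"
    using skew_adjoint_one_minus_invertible[of "- z"] sz by (auto simp: star_minus)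
  have NW: "N * (v * w) = 1" "v * w * N = 1"
    using v w unfolding N_def by (metis mult.assoc mult_1_left)+
  define W where "W = v * w"
  have ss: "star e * star e = star e" using e by (metis star_mult)
  have e3: "e * (e * x) = e * x" "star e * (star e * x) = star e * x" for x
    using e ss by (metis mult.assoc)+
  have eN: "e * N = e * star e * e" and Ne: "N * e = e * star e * e"
    by (simp_all add: N_def z_def algebra_simps e ss e3)
  have sN: "star N = N" by (simp add: N_def star_mult star_add star_diff sz algebra_simps)
  have "star W * N = 1" using NW(1) sN by (metis W_def star_mult star_one)
  then have sW: "star W = W" using NW(1) by (metis W_def mult.assoc mult_1_left mult_1_right)
  have We: "W * e = e * W"
    using NW eN Ne unfolding W_def[symmetric] by (metis mult.assoc mult_1_left mult_1_right)
  then have Ws: "W * star e = star e * W" using sW by (metis star_mult)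
  define p where "p = e * star e * W"
  have "star p = p"
    by (simp add: p_def star_mult star_star sW mult.assoc) (metis We Ws mult.assoc)
  moreover have "p * e = e"
    using NW(1) eN We unfolding p_def W_def[symmetric] by (metis mult.assoc mult_1_right)
  moreover have "e * p = p" by (simp add: p_def mult.assoc e3)
  ultimately show ?thesis by (rule that)
qed

text \<open>An inner inverse \<open>y\<close> is corrected to \<open>q * y * p\<close>, where
  \<open>p\<close> projects onto the range of \<open>x * y\<close> and \<open>q\<close> has the
  kernel of \<open>y * x\<close>. Its products with \<open>x\<close> are then \<open>p\<close> and
  \<open>q\<close>, which are self-adjoint.\<close>

lemma regular_element_is_mp_inverse:
  fixes x :: "'a::unital_cstar_algebra"
  assumes "regular_element x"
  shows "is_mp_inverse x (mp_inverse x)"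
proof -
  obtain y where y: "x = x * y * x" using assms unfolding regular_element_def by blast
  have "(x * y) * (x * y) = x * y" using y by (metis mult.assoc)
  then obtain p where p: "star p = p" "p * (x * y) = x * y" "x * y * p = p"
    by (rule range_projection_exists)
  \<comment> \<open>A projection with the kernel of \<open>y * x\<close> is one with the range of
    its adjoint.\<close>
  have "star (y * x) * star (y * x) = star (y * x)" using y by (metis mult.assoc star_mult)
  then obtain q where q: "star q = q" "q * star (y * x) = star (y * x)" "star (y * x) * q = q"
    by (rule range_projection_exists)
  have q': "y * x * q = y * x" "q * (y * x) = q"
    using q by (metis star_mult star_star)+
  have px: "p * x = x" and xq: "x * q = x" using p q' y by (metis mult.assoc)+
  have 1: "x * (q * y * p) = p" using xq p by (metis mult.assoc)
  have 2: "(q * y * p) * x = q" using px q' by (metis mult.assoc)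
  have "q * q = q" using q by (metis mult.assoc)
  then have "is_mp_inverse x (q * y * p)"
    unfolding is_mp_inverse_def 1 2 using p q px by (simp add: mult.assoc[symmetric])
  then show ?thesis using mp_inverse_eq by metis
qed

lemma mp_inverse_star:
  fixes x :: "'a::unital_cstar_algebra"
  assumes "regular_element x"
  shows "mp_inverse (star x) = star (mp_inverse x)"
proof (rule mp_inverse_eq)
  have "is_mp_inverse x (mp_inverse x)" using assms by (rule regular_element_is_mp_inverse)
  then show "is_mp_inverse (star x) (star (mp_inverse x))"
    unfolding is_mp_inverse_def by (metis star_mult mult.assoc)
qed

lemma regular_element_star:
  fixes x :: "'a::unital_cstar_algebra"
  shows "regular_element x \<Longrightarrow> regular_element (star x)"
  unfolding regular_element_def by (metis star_mult mult.assoc)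

subsection \<open>Convergence\<close>

text \<open>Once \<open>norm (d n) < 1 / 2\<close>, the term \<open>d n * x n\<close> is absorbed
  into the left side at the cost of a factor 2. This bounds generalized inverses through an identity
  they satisfy.\<close>

lemma Bseq_if_perturbed_left:
  fixes x :: "nat \<Rightarrow> 'a::real_normed_algebra"
  assumes x: "\<And>n. x n = d n * x n + e n" and d: "d \<longlonglongrightarrow> 0" and e: "Bseq e"
  shows "Bseq x"
proof -
  obtain K where K: "\<And>n. norm (e n) \<le> K" using e by (auto simp: Bseq_def)
  have "\<forall>\<^sub>F n in sequentially. norm (d n) < 1 / 2"
    using tendstoD[OF d, of "1 / 2"] by (simp add: dist_norm)
  then have "\<forall>\<^sub>F n in sequentially. norm (x n) \<le> norm (2 * K)"
  proof eventually_elim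
    case (elim n)
    have "norm (x n) \<le> norm (d n * x n) + norm (e n)" by (metis x norm_triangle_ineq)
    also have "\<dots> \<le> norm (d n) * norm (x n) + K" using K norm_mult_ineq by (intro add_mono)
    also have "\<dots> \<le> 1 / 2 * norm (x n) + K" using elim by (intro add_mono mult_right_mono) auto
    finally show ?case by simp
  qed
  then show ?thesis by (rule Bseq_eventually_mono) (rule Bfun_const)
qed

lemma tendsto_zero_mult_Bseq:
  fixes x d :: "nat \<Rightarrow> 'a::real_normed_algebra"
  assumes "d \<longlonglongrightarrow> 0" "Bseq x"
  shows "(\<lambda>n. d n * x n) \<longlonglongrightarrow> 0"
  using bounded_bilinear.Zfun_prod_Bfun[OF bounded_bilinear_mult] assms
  by (auto simp: tendsto_Zfun_iff)

text \<open>The identity \<open>z' n = d n * z' n + z * (b' n * z' n)\<close> with \<open>d\<close>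
  tending to 0 first bounds \<open>z'\<close>, as \<open>b' n * z' n\<close> is a projection. The
  bound makes these projections converge to \<open>b * z\<close>, and the identity then yields the
  limit \<open>z * (b * z) = z\<close>.\<close>

lemma tendsto_mp_inverse_if_support:
  fixes b :: "'a::unital_cstar_algebra"
  assumes b: "regular_element b" and b': "\<And>n. regular_element (b' n)"
    and lim: "b' \<longlonglongrightarrow> b" and Q: "(\<lambda>n. mp_inverse (b' n) * b' n) \<longlonglongrightarrow> mp_inverse b * b"
  shows "(\<lambda>n. mp_inverse (b' n)) \<longlonglongrightarrow> mp_inverse b"
proof -
  define z where "z = mp_inverse b"
  define z' where "z' n = mp_inverse (b' n)" for n
  have z: "b * z * b = b" "z * b * z = z" "star (b * z) = b * z"
    using regular_element_is_mp_inverse[OF b] by (simp_all add: is_mp_inverse_def z_def)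
  have z': "b' n * z' n * b' n = b' n" "z' n * b' n * z' n = z' n" "star (b' n * z' n) = b' n * z' n"
    for n using regular_element_is_mp_inverse[OF b', of n] by (simp_all add: is_mp_inverse_def z'_def)
  have dQ: "(\<lambda>n. z' n * b' n - z * b) \<longlonglongrightarrow> 0" and db: "(\<lambda>n. b - b' n) \<longlonglongrightarrow> 0"
    using LIM_zero[OF Q] tendsto_diff[OF tendsto_const lim, of b] by (auto simp: z_def z'_def)
  define d where "d n = (z' n * b' n - z * b) + z * (b - b' n)" for n
  have d0: "d \<longlonglongrightarrow> 0"
    unfolding d_def using tendsto_add[OF dQ tendsto_mult_right_zero[OF db, of z]] by simp
  have eq: "z' n = d n * z' n + z * (b' n * z' n)" for n
    by (simp add: d_def algebra_simps) (simp add: z' flip: mult.assoc)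
  have nP: "norm (b' n * z' n) \<le> 1" for n
    using z'[of n] by (intro norm_projection_le_one) (simp_all add: mult.assoc[symmetric])
  have "norm (z * (b' n * z' n)) \<le> norm z * 1" for n
    by (meson norm_mult_ineq mult_left_mono nP norm_ge_zero order_trans)
  then have "Bseq (\<lambda>n. z * (b' n * z' n))" by (rule BseqI')
  then have Bz: "Bseq z'" by (rule Bseq_if_perturbed_left[OF eq d0])
  \<comment> \<open>With \<open>P = b * z\<close> and \<open>P' = b' n * z' n\<close>, these are
    \<open>r n = P' * (1 - P)\<close> and \<open>s n = (1 - P') * P\<close>, written so that the
    small factor \<open>b' n - b\<close> is visible.\<close>
  define r where "r n = star (z' n) * (star (b' n - b) * (1 - b * z))" for n
  define s where "s n = (1 - b' n * z' n) * ((b - b' n) * z)" for n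
  have P: "(1 - b * z) * b = 0" and P': "(1 - b' n * z' n) * b' n = 0" for n
    using z z' by (simp_all add: algebra_simps)
  have "star (r n) = (1 - b * z) * (b' n - b) * z' n" for n
    using z by (simp add: r_def star_mult star_star star_diff)
  then have "star (r n) = (1 - b * z) * (b' n * z' n)" for n
    using P by (simp add: right_diff_distrib mult.assoc)
  then have r: "r n = b' n * z' n * (1 - b * z)" for n
    using z z' by (metis star_mult star_star star_diff star_one)
  have "s n = (1 - b' n * z' n) * b * z" for n
    using P'[of n] by (simp add: s_def left_diff_distrib right_diff_distrib flip: mult.assoc)
  then have rs: "r n - s n = b' n * z' n - b * z" for n
    unfolding r by (simp add: algebra_simps)
  have db': "(\<lambda>n. b' n - b) \<longlonglongrightarrow> 0" using lim by (simp add: LIM_zero)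
  have "(\<lambda>n. (1 - b * z) * (b' n - b) * z' n) \<longlonglongrightarrow> 0"
    by (intro tendsto_zero_mult_Bseq Bz tendsto_mult_right_zero db')
  from tendsto_star[OF this] have r0: "r \<longlonglongrightarrow> 0"
    using z by (simp add: r_def[abs_def] star_mult star_star star_diff mult.assoc)
  have "norm (1 - b' n * z' n) \<le> 1 + 1" for n
    using norm_triangle_ineq4[of 1 "b' n * z' n"] nP[of n] by simp
  then have "Bseq (\<lambda>n. 1 - b' n * z' n)" by (rule BseqI')
  \<comment> \<open>In \<open>s n\<close> the null factor is on the right; passing to adjoints moves
    it to the left, as \<open>tendsto_zero_mult_Bseq\<close> requires.\<close>
  moreover have "(\<lambda>n. star ((b - b' n) * z)) \<longlonglongrightarrow> 0"
    using tendsto_star[OF tendsto_mult_left_zero[OF db, of z]] by simp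
  ultimately have "(\<lambda>n. star ((b - b' n) * z) * (1 - b' n * z' n)) \<longlonglongrightarrow> 0"
    by (intro tendsto_zero_mult_Bseq)
  from tendsto_star[OF this] have s0: "s \<longlonglongrightarrow> 0"
    using z' by (simp add: s_def[abs_def] star_mult star_star star_diff mult.assoc)
  have dP: "(\<lambda>n. b' n * z' n) \<longlonglongrightarrow> b * z"
    using tendsto_diff[OF r0 s0] unfolding rs by (simp add: LIM_zero_iff)
  have "(\<lambda>n. d n * z' n + z * (b' n * z' n)) \<longlonglongrightarrow> 0 + z * (b * z)"
    by (intro tendsto_add tendsto_zero_mult_Bseq d0 Bz tendsto_mult tendsto_const dP)
  then have "z' \<longlonglongrightarrow> z" using z(2) by (simp add: mult.assoc flip: eq)
  then show ?thesis by (simp add: z_def z'_def[abs_def])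
qed

lemma tendsto_mp_inverse_iff_support:
  fixes b :: "'a::unital_cstar_algebra"
  assumes "regular_element b" "\<And>n. regular_element (b' n)" "b' \<longlonglongrightarrow> b"
  shows "(\<lambda>n. mp_inverse (b' n)) \<longlonglongrightarrow> mp_inverse b \<longleftrightarrow>
    (\<lambda>n. mp_inverse (b' n) * b' n) \<longlonglongrightarrow> mp_inverse b * b"
  using tendsto_mp_inverse_if_support[OF assms] tendsto_mult[OF _ assms(3)] by blast

text \<open>This is the support version for adjoints: the support projection of
  \<open>star b\<close> is the range projection of \<open>b\<close>.\<close>

lemma tendsto_mp_inverse_iff_range:
  fixes b :: "'a::unital_cstar_algebra"
  assumes b: "regular_element b" "\<And>n. regular_element (b' n)" and lim: "b' \<longlonglongrightarrow> b"
  shows "(\<lambda>n. mp_inverse (b' n)) \<longlonglongrightarrow> mp_inverse b \<longleftrightarrow>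
    (\<lambda>n. b' n * mp_inverse (b' n)) \<longlonglongrightarrow> b * mp_inverse b"
proof -
  have star_iff: "(\<lambda>n. star (x n)) \<longlonglongrightarrow> star l \<longleftrightarrow> x \<longlonglongrightarrow> l" for x :: "nat \<Rightarrow> 'a" and l
    using tendsto_star[of x l sequentially] tendsto_star[of "\<lambda>n. star (x n)" "star l" sequentially]
    by (auto simp: star_star)
  have "star (mp_inverse x) * star x = x * mp_inverse x" if "regular_element x" for x :: 'a
    using regular_element_is_mp_inverse[OF that] by (simp add: is_mp_inverse_def flip: star_mult)
  then show ?thesis
    using tendsto_mp_inverse_iff_support[OF regular_element_star regular_element_star tendsto_star, OF b lim]
    by (simp add: b mp_inverse_star star_iff)
qed

text \<open>The equivalence of (i) to (iv) uses the (b,c)-inverse only through these relations.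
  Membership of \<open>y\<close> in the two product sets makes \<open>p\<close> and \<open>q\<close>
  fix \<open>y\<close>; \<open>b = y * a * b\<close> and \<open>c = c * a * y\<close> give the other
  two products.\<close>

lemma bc_inverse_properties:
  fixes a b c :: "'a::unital_cstar_algebra"
  assumes "regular_element b" "regular_element c" "bc_invertible b c a"
  defines "y \<equiv> bc_inverse b c a" and "p \<equiv> b * mp_inverse b" and "q \<equiv> mp_inverse c * c"
  shows "p * y = y" "y * a * p = p" "y * q = y" "q * (a * y) = q"
    "star p = p" "star q = q"
proof -
  have "is_bc_inverse b c a y"
    using assms(3) bc_inverse_eq unfolding y_def bc_invertible_def by blast
  then obtain u v where y: "y = b * v * y" "y = y * u * c" "b = y * a * b" "c = c * a * y"
    unfolding is_bc_inverse_def by blast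
  have b: "b * mp_inverse b * b = b" "star p = p" and c: "c * mp_inverse c * c = c" "star q = q"
    using assms(1,2) regular_element_is_mp_inverse unfolding is_mp_inverse_def p_def q_def by metis+
  show "p * y = y" using y(1) b(1) unfolding p_def by (metis mult.assoc)
  show "y * a * p = p" using y(3) unfolding p_def by (metis mult.assoc)
  show "y * q = y" using y(2) c(1) unfolding q_def by (metis mult.assoc)
  show "q * (a * y) = q" using y(4) unfolding q_def by (metis mult.assoc)
  show "star p = p" "star q = q" by (fact b c)+
qed

lemma tendsto_outer_inverse:
  fixes y a p q :: "'a::real_normed_algebra_1"
  assumes lim: "a' \<longlonglongrightarrow> a" "p' \<longlonglongrightarrow> p" "q' \<longlonglongrightarrow> q"
    and y: "y * a * p = p" "y * q = y"
    and y': "\<And>n. p' n * y' n = y' n" "\<And>n. q' n * (a' n * y' n) = q' n"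
  shows "y' \<longlonglongrightarrow> y"
proof -
  define d where "d n = (1 - y * a) * (p' n - p) + y * (a - a' n) + y * (q - q' n) * a' n" for n
  define e where "e n = y - y * (q - q' n)" for n
  have "d \<longlonglongrightarrow> (1 - y * a) * (p - p) + y * (a - a) + y * (q - q) * a"
    unfolding d_def by (intro tendsto_intros lim)
  then have d0: "d \<longlonglongrightarrow> 0" by simp
  have "e \<longlonglongrightarrow> y - y * (q - q)" unfolding e_def by (intro tendsto_intros lim)
  then have e: "e \<longlonglongrightarrow> y" by simp
  have "(1 - y * a) * (p' n - p) * y' n = (1 - y * a) * y' n" for n
    using y'(1)[of n] arg_cong[OF y(1), of "\<lambda>x. x * y' n"]
    by (simp add: left_diff_distrib right_diff_distrib mult.assoc)
  moreover have "y * (q - q' n) * a' n * y' n = y * a' n * y' n - y * q' n" for n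
    using y(2) y'(2)[of n] by (simp add: left_diff_distrib right_diff_distrib mult.assoc)
  \<comment> \<open>The three parts of \<open>d n * y' n\<close> telescope to
    \<open>y' n - y * q' n\<close>, while \<open>e n = y * q' n\<close>.\<close>
  ultimately have eq: "y' n = d n * y' n + e n" for n
    using y(2) by (simp add: d_def e_def distrib_right) (simp add: algebra_simps)
  have "Bseq y'" using d0 e by (intro Bseq_if_perturbed_left[OF eq] convergent_imp_Bseq convergentI)
  then have "(\<lambda>n. d n * y' n + e n) \<longlonglongrightarrow> 0 + y"
    by (intro tendsto_add tendsto_zero_mult_Bseq d0 e)
  then show ?thesis by (simp flip: eq)
qed

theorem theorem5p6:
  fixes a b c :: "'a::unital_cstar_algebra"
    and a' b' c' :: "nat \<Rightarrow> 'a"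
  assumes "regular_element b" and "regular_element c"
    and "bc_invertible b c a"
    and "bc_inverse b c a \<noteq> 0"
    and "\<And>n. regular_element (b' n)" and "\<And>n. regular_element (c' n)"
    and "\<And>n. bc_invertible (b' n) (c' n) (a' n)"
    and "a' \<longlonglongrightarrow> a"
  shows "(((\<lambda>n. bc_inverse (b' n) (c' n) (a' n)) \<longlonglongrightarrow> bc_inverse b c a)
         \<longleftrightarrow>
         (((\<lambda>n. bc_inverse (b' n) (c' n) (a' n) * a' n) \<longlonglongrightarrow> bc_inverse b c a * a) \<and>
          ((\<lambda>n. mp_inverse (c' n) * c' n) \<longlonglongrightarrow> mp_inverse c * c))) \<and>
        ((((\<lambda>n. bc_inverse (b' n) (c' n) (a' n) * a' n) \<longlonglongrightarrow> bc_inverse b c a * a) \<and>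
          ((\<lambda>n. mp_inverse (c' n) * c' n) \<longlonglongrightarrow> mp_inverse c * c))
         \<longleftrightarrow>
         (((\<lambda>n. a' n * bc_inverse (b' n) (c' n) (a' n)) \<longlonglongrightarrow> a * bc_inverse b c a) \<and>
          ((\<lambda>n. b' n * mp_inverse (b' n)) \<longlonglongrightarrow> b * mp_inverse b))) \<and>
        ((((\<lambda>n. a' n * bc_inverse (b' n) (c' n) (a' n)) \<longlonglongrightarrow> a * bc_inverse b c a) \<and>
          ((\<lambda>n. b' n * mp_inverse (b' n)) \<longlonglongrightarrow> b * mp_inverse b))
         \<longleftrightarrow>
         (((\<lambda>n. b' n * mp_inverse (b' n)) \<longlonglongrightarrow> b * mp_inverse b) \<and>
          ((\<lambda>n. mp_inverse (c' n) * c' n) \<longlonglongrightarrow> mp_inverse c * c))) \<and>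
        (b' \<longlonglongrightarrow> b \<longrightarrow>
         ((((\<lambda>n. a' n * bc_inverse (b' n) (c' n) (a' n)) \<longlonglongrightarrow> a * bc_inverse b c a) \<and>
          ((\<lambda>n. b' n * mp_inverse (b' n)) \<longlonglongrightarrow> b * mp_inverse b))
         \<longleftrightarrow>
         (((\<lambda>n. a' n * bc_inverse (b' n) (c' n) (a' n)) \<longlonglongrightarrow> a * bc_inverse b c a) \<and>
          ((\<lambda>n. mp_inverse (b' n)) \<longlonglongrightarrow> mp_inverse b)))) \<and>
        (c' \<longlonglongrightarrow> c \<longrightarrow>
         ((((\<lambda>n. bc_inverse (b' n) (c' n) (a' n) * a' n) \<longlonglongrightarrow> bc_inverse b c a * a) \<and>
          ((\<lambda>n. mp_inverse (c' n) * c' n) \<longlonglongrightarrow> mp_inverse c * c))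
         \<longleftrightarrow>
         (((\<lambda>n. bc_inverse (b' n) (c' n) (a' n) * a' n) \<longlonglongrightarrow> bc_inverse b c a * a) \<and>
          ((\<lambda>n. mp_inverse (c' n)) \<longlonglongrightarrow> mp_inverse c)))) \<and>
        (b' \<longlonglongrightarrow> b \<longrightarrow> c' \<longlonglongrightarrow> c \<longrightarrow>
         ((((\<lambda>n. b' n * mp_inverse (b' n)) \<longlonglongrightarrow> b * mp_inverse b) \<and>
          ((\<lambda>n. mp_inverse (c' n) * c' n) \<longlonglongrightarrow> mp_inverse c * c))
         \<longleftrightarrow>
         (((\<lambda>n. mp_inverse (b' n)) \<longlonglongrightarrow> mp_inverse b) \<and>
          ((\<lambda>n. mp_inverse (c' n)) \<longlonglongrightarrow> mp_inverse c))))"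
proof -
  define y where "y = bc_inverse b c a"
  define p where "p = b * mp_inverse b"
  define q where "q = mp_inverse c * c"
  define y' where "y' n = bc_inverse (b' n) (c' n) (a' n)" for n
  define p' where "p' n = b' n * mp_inverse (b' n)" for n
  define q' where "q' n = mp_inverse (c' n) * c' n" for n
  note y = bc_inverse_properties[OF assms(1-3), folded y_def p_def q_def]
  note y' = bc_inverse_properties[OF assms(5-7), folded y'_def p'_def q'_def]
  have p: "p' \<longlonglongrightarrow> p" if "(\<lambda>n. y' n * a' n) \<longlonglongrightarrow> y * a"
  proof (rule tendsto_range_projection[OF _ _ _ _ _ _ that])
    show "p * (y * a) = y * a" "\<And>n. p' n * (y' n * a' n) = y' n * a' n"
      by (simp_all add: y y' flip: mult.assoc)
  qed (simp_all add: y y')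
  \<comment> \<open>Here \<open>q\<close> has the kernel of \<open>a * y\<close>, hence the range of
    \<open>star (a * y)\<close>, so the range lemma is applied to adjoints.\<close>
  have q: "q' \<longlonglongrightarrow> q" if "(\<lambda>n. a' n * y' n) \<longlonglongrightarrow> a * y"
  proof (rule tendsto_range_projection[OF _ _ _ _ _ _ tendsto_star[OF that]])
    show "q * star (a * y) = star (a * y)" "\<And>n. q' n * star (a' n * y' n) = star (a' n * y' n)"
      using y y' by (metis star_mult mult.assoc)+
    show "star (a * y) * q = q" "\<And>n. star (a' n * y' n) * q' n = q' n"
      using y y' by (metis star_mult)+
  qed (simp_all add: y y')
  have i: "y' \<longlonglongrightarrow> y" if "p' \<longlonglongrightarrow> p" "q' \<longlonglongrightarrow> q"
    using assms(8) that y(2,3) y'(1,4) by (rule tendsto_outer_inverse)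
  have ya: "(\<lambda>n. y' n * a' n) \<longlonglongrightarrow> y * a" "(\<lambda>n. a' n * y' n) \<longlonglongrightarrow> a * y" if "y' \<longlonglongrightarrow> y"
    using that assms(8) by (simp_all add: tendsto_mult)
  have b: "(\<lambda>n. mp_inverse (b' n)) \<longlonglongrightarrow> mp_inverse b \<longleftrightarrow> p' \<longlonglongrightarrow> p" if "b' \<longlonglongrightarrow> b"
    unfolding p_def p'_def[abs_def] using assms(1,5) that by (rule tendsto_mp_inverse_iff_range)
  have c: "(\<lambda>n. mp_inverse (c' n)) \<longlonglongrightarrow> mp_inverse c \<longleftrightarrow> q' \<longlonglongrightarrow> q" if "c' \<longlonglongrightarrow> c"
    unfolding q_def q'_def[abs_def] using assms(2,6) that by (rule tendsto_mp_inverse_iff_support)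
  \<comment> \<open>All equivalences pass through (iv): \<open>p\<close> and \<open>q\<close> supply
    the missing projection limit in (ii) and (iii), \<open>i\<close> leads from (iv) to (i), and
    \<open>ya\<close> returns from (i) to the products.\<close>
  show ?thesis
    unfolding y_def[symmetric] p_def[symmetric] q_def[symmetric]
      y'_def[symmetric] p'_def[symmetric] q'_def[symmetric]
    using p q i ya b c by blast
qed

end
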